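(* Let $G$ be a Garside group of finite type with Garside structure $(G,P,\Delta)$. Let $x\in G$, $z\in\mathrm{SC}(x)$, $y=\mathfrak s(z)$ and let $s\in G$ be positive such that $y^s\in\mathrm{SSS}(x)$. Then the pullback of $s$ at $y$ is $$s_{(1)}=\big(\mathfrak p(z)\; s\;\mathfrak p^{\Lsh}(y^s)^{-1}\big)\vee 1 .$$
   Context: Garside groups. Let $G$ be a group, $P\subseteq G$ a submonoid with $P\cap P^{-1}=\{1\}$ (its elements are called positive) and $\Delta\in P$. $(G,P,\Delta)$ is a Garside structure if: (1) the left-invariant partial order $a\preccurlyeq b\Leftrightarrow a^{-1}b\in P$ is a lattice order on $G$, with gcd $a\wedge b$ and lcm $a\vee b$; (2) the set $[1,\Delta]=\{s\in G: 1\preccurlyeq s\preccurlyeq\Delta\}$ of simple elements generates $G$; (3) $\Delta^{-1}P\Delta=P$; (4) for all $x\in P\setminus\{1\}$, $\|x\|=\sup\{k: x=a_1\cdots a_k,\ a_i\in P\setminus\{1\}\}<\infty$. It is of finite type if $[1,\Delta]$ is finite. Throughout, $G\neq\{1\}$ has a fixed Garside structure $(G,P,\Delta)$ of finite type. The right-invariant order $a\succcurlyeq b\Leftrightarrow ab^{-1}\in P$ is also a lattice order; its gcd is denoted $a\wedge^{\Lsh}b$. Notation: $x^c=c^{-1}xc$. $\inf(x)$ and $\sup(x)$ are the maximal and minimal integers, respectively, with $\Delta^{\inf(x)}\preccurlyeq x\preccurlyeq\Delta^{\sup(x)}$. $\mathrm{SSS}(x)$ is the set of conjugates $y$ of $x$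 such that $\inf(y)$ is maximal and $\sup(y)$ is minimal among all conjugates of $x$. The preferred prefix of $x$ is $\mathfrak p(x)=(x\Delta^{-\inf(x)})\wedge(x^{-1}\Delta^{\sup(x)})\wedge\Delta$; the preferred suffix is $\mathfrak p^{\Lsh}(x)=(\Delta^{-\inf(x)}x)\wedge^{\Lsh}(\Delta^{\sup(x)}x^{-1})\wedge^{\Lsh}\Delta$; the cyclic sliding of $x$ is $\mathfrak s(x)=x^{\mathfrak p(x)}$. $\mathrm{SC}(x)$ is the set of all conjugates $y$ of $x$ with $\mathfrak s^m(y)=y$ for some $m\ge 1$. The transport of $\alpha\in G$ at $x\in G$ is $\alpha^{(1)}=\mathfrak p(x)^{-1}\alpha\,\mathfrak p(x^\alpha)$. For $z\in\mathrm{SC}(x)$, $y=\mathfrak s(z)$ and $s\in P$, the pullback $s_{(1)}$ of $s$ at $y$ is the unique $\preccurlyeq$-minimal positive element such that $z^{s_{(1)}}\in\mathrm{SSS}(x)$ and $s\preccurlyeq (s_{(1)})^{(1)}$, the transport being taken at $z$. *)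

theory Defs
  imports "HOL-Algebra.Algebra" "HOL-Library.Extended_Nat"
begin

definition left_order :: "('a, 'm) monoid_scheme \<Rightarrow> 'a set \<Rightarrow> 'a gorder" where
  "left_order G P = \<lparr>carrier = carrier G, eq = (=), le = (\<lambda>a b. inv\<^bsub>G\<^esub> a \<otimes>\<^bsub>G\<^esub> b \<in> P)\<rparr>"

text \<open>The right-invariant order is usually written with the larger element on the left;
  here \<open>b \<sqsubseteq> a\<close> means \<open>a \<otimes> inv b \<in> P\<close>, so that \<open>\<sqinter>\<close> is the right gcd.\<close>

definition right_order :: "('a, 'm) monoid_scheme \<Rightarrow> 'a set \<Rightarrow> 'a gorder" where
  "right_order G P = \<lparr>carrier = carrier G, eq = (=), le = (\<lambda>b a. a \<otimes>\<^bsub>G\<^esub> inv\<^bsub>G\<^esub> b \<in> P)\<rparr>"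

definition simple_elements :: "('a, 'm) monoid_scheme \<Rightarrow> 'a set \<Rightarrow> 'a \<Rightarrow> 'a set" where
  "simple_elements G P \<Delta> = \<lbrace>\<one>\<^bsub>G\<^esub>..\<Delta>\<rbrace>\<^bsub>left_order G P\<^esub>"

definition garside_norm :: "('a, 'm) monoid_scheme \<Rightarrow> 'a set \<Rightarrow> 'a \<Rightarrow> enat" where
  "garside_norm G P x =
     Sup {enat (length as) | as. set as \<subseteq> P - {\<one>\<^bsub>G\<^esub>} \<and> x = foldr (\<otimes>\<^bsub>G\<^esub>) as \<one>\<^bsub>G\<^esub>}"

locale garside_structure = group G for G (structure) +
  fixes P :: "'a set" and \<Delta> :: 'a
  assumes positive_submonoid: "submonoid P G"
    and positive_Int_inverse: "P \<inter> (set_inv P) = {\<one>}"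
    and Delta_positive: "\<Delta> \<in> P"
    and left_lattice: "lattice (left_order G P)"
    and simple_generate: "generate G (simple_elements G P \<Delta>) = carrier G"
    and Delta_conj_positive: "(\<lambda>p. inv \<Delta> \<otimes> p \<otimes> \<Delta>) ` P = P"
    and norm_finite: "x \<in> P - {\<one>} \<Longrightarrow> garside_norm G P x < \<infinity>"

locale finite_type_garside_structure = garside_structure +
  assumes finite_simple: "finite (simple_elements G P \<Delta>)"

definition conjugate :: "('a, 'm) monoid_scheme \<Rightarrow> 'a \<Rightarrow> 'a \<Rightarrow> 'a" where
  "conjugate G x c = inv\<^bsub>G\<^esub> c \<otimes>\<^bsub>G\<^esub> x \<otimes>\<^bsub>G\<^esub> c"

definition conjugates :: "('a, 'm) monoid_scheme \<Rightarrow> 'a \<Rightarrow> 'a set" where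
  "conjugates G x = conjugate G x ` carrier G"

definition garside_inf :: "('a, 'm) monoid_scheme \<Rightarrow> 'a set \<Rightarrow> 'a \<Rightarrow> 'a \<Rightarrow> int" where
  "garside_inf G P \<Delta> x = (GREATEST k::int. \<Delta> [^]\<^bsub>G\<^esub> k \<sqsubseteq>\<^bsub>left_order G P\<^esub> x)"

definition garside_sup :: "('a, 'm) monoid_scheme \<Rightarrow> 'a set \<Rightarrow> 'a \<Rightarrow> 'a \<Rightarrow> int" where
  "garside_sup G P \<Delta> x = (LEAST k::int. x \<sqsubseteq>\<^bsub>left_order G P\<^esub> \<Delta> [^]\<^bsub>G\<^esub> k)"

definition super_summit_set :: "('a, 'm) monoid_scheme \<Rightarrow> 'a set \<Rightarrow> 'a \<Rightarrow> 'a \<Rightarrow> 'a set" where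
  "super_summit_set G P \<Delta> x =
     {y \<in> conjugates G x. \<forall>w \<in> conjugates G x.
        garside_inf G P \<Delta> w \<le> garside_inf G P \<Delta> y \<and> garside_sup G P \<Delta> y \<le> garside_sup G P \<Delta> w}"

definition preferred_prefix :: "('a, 'm) monoid_scheme \<Rightarrow> 'a set \<Rightarrow> 'a \<Rightarrow> 'a \<Rightarrow> 'a" where
  "preferred_prefix G P \<Delta> x =
     (x \<otimes>\<^bsub>G\<^esub> \<Delta> [^]\<^bsub>G\<^esub> (- garside_inf G P \<Delta> x))
     \<sqinter>\<^bsub>left_order G P\<^esub> (inv\<^bsub>G\<^esub> x \<otimes>\<^bsub>G\<^esub> \<Delta> [^]\<^bsub>G\<^esub> garside_sup G P \<Delta> x)
     \<sqinter>\<^bsub>left_order G P\<^esub> \<Delta>"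

definition preferred_suffix :: "('a, 'm) monoid_scheme \<Rightarrow> 'a set \<Rightarrow> 'a \<Rightarrow> 'a \<Rightarrow> 'a" where
  "preferred_suffix G P \<Delta> x =
     (\<Delta> [^]\<^bsub>G\<^esub> (- garside_inf G P \<Delta> x) \<otimes>\<^bsub>G\<^esub> x)
     \<sqinter>\<^bsub>right_order G P\<^esub> (\<Delta> [^]\<^bsub>G\<^esub> garside_sup G P \<Delta> x \<otimes>\<^bsub>G\<^esub> inv\<^bsub>G\<^esub> x)
     \<sqinter>\<^bsub>right_order G P\<^esub> \<Delta>"

definition cyclic_sliding :: "('a, 'm) monoid_scheme \<Rightarrow> 'a set \<Rightarrow> 'a \<Rightarrow> 'a \<Rightarrow> 'a" where
  "cyclic_sliding G P \<Delta> x = conjugate G x (preferred_prefix G P \<Delta> x)"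

definition sliding_circuits :: "('a, 'm) monoid_scheme \<Rightarrow> 'a set \<Rightarrow> 'a \<Rightarrow> 'a \<Rightarrow> 'a set" where
  "sliding_circuits G P \<Delta> x =
     {y \<in> conjugates G x. \<exists>m\<ge>1. (cyclic_sliding G P \<Delta> ^^ m) y = y}"

definition transport :: "('a, 'm) monoid_scheme \<Rightarrow> 'a set \<Rightarrow> 'a \<Rightarrow> 'a \<Rightarrow> 'a \<Rightarrow> 'a" where
  "transport G P \<Delta> x \<alpha> =
     inv\<^bsub>G\<^esub> (preferred_prefix G P \<Delta> x) \<otimes>\<^bsub>G\<^esub> \<alpha> \<otimes>\<^bsub>G\<^esub> preferred_prefix G P \<Delta> (conjugate G x \<alpha>)"

definition is_minimal_in :: "('a, 'm) gorder_scheme \<Rightarrow> 'a set \<Rightarrow> 'a \<Rightarrow> bool" where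
  "is_minimal_in L A p \<longleftrightarrow> p \<in> A \<and> (\<forall>q \<in> A. q \<sqsubseteq>\<^bsub>L\<^esub> p \<longrightarrow> q = p)"

definition pullback_candidates ::
    "('a, 'm) monoid_scheme \<Rightarrow> 'a set \<Rightarrow> 'a \<Rightarrow> 'a \<Rightarrow> 'a \<Rightarrow> 'a \<Rightarrow> 'a set" where
  "pullback_candidates G P \<Delta> x z s =
     {t \<in> P. conjugate G z t \<in> super_summit_set G P \<Delta> x
             \<and> s \<sqsubseteq>\<^bsub>left_order G P\<^esub> transport G P \<Delta> z t}"

text \<open>\<open>is_pullback G P \<Delta> x z s t\<close>: \<open>t\<close> is the pullback of \<open>s\<close> at the element
  \<open>cyclic_sliding G P \<Delta> z\<close>, where \<open>z\<close> lies in \<open>sliding_circuits G P \<Delta> x\<close>.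
  It is a predicate rather than a definite description, so that asserting it
  includes both existence and uniqueness of the minimal element.\<close>

definition is_pullback ::
    "('a, 'm) monoid_scheme \<Rightarrow> 'a set \<Rightarrow> 'a \<Rightarrow> 'a \<Rightarrow> 'a \<Rightarrow> 'a \<Rightarrow> 'a \<Rightarrow> bool" where
  "is_pullback G P \<Delta> x z s t \<longleftrightarrow>
     is_minimal_in (left_order G P) (pullback_candidates G P \<Delta> x z s) t
     \<and> (\<forall>t'. is_minimal_in (left_order G P) (pullback_candidates G P \<Delta> x z s) t' \<longrightarrow> t' = t)"

end

theory Submission
  imports Defs
begin

text \<open>Write \<open>c = \<pp>(z) s\<close> and \<open>w = z\<^sup>c = y\<^sup>s\<close>. Since \<open>a \<pp>(z\<^sup>a)\<close> is the gcd of \<open>z a \<Delta>\<^sup>-\<^sup>p\<close>,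
  \<open>z\<^sup>-\<^sup>1 a \<Delta>\<^sup>q\<close> and \<open>a \<Delta>\<close>, the transport condition \<open>s \<preceq> a\<^sup>(\<^sup>1\<^sup>)\<close>, i.e. \<open>c \<preceq> a \<pp>(z\<^sup>a)\<close>, amounts to three
  lower bounds on \<open>a\<close>, whose lcm is \<open>c\<close> times the inverse of the preferred suffix of \<open>w\<close>. The lcm of
  this element with 1 conjugates \<open>z\<close> into the super summit set by convexity, once \<open>z\<close> itself is known
  to lie there.

  For the latter, suppose that \<open>z\<close> lies on a sliding circuit, along which the infimum \<open>p\<close> and the
  supremum \<open>q\<close> are necessarily constant, and that some \<open>z\<^sup>a\<close> has infimum greater than \<open>p\<close>, i.e.
  \<open>a \<preceq> h a\<close> for \<open>h a = z a \<Delta>\<^sup>-\<^sup>p\<^sup>-\<^sup>1\<close>. We may take \<open>a \<preceq> 1\<close>. Then the gcds of \<open>1, h 1, \<dots>, h\<^sup>k 1\<close> are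
  bounded below by \<open>a\<close>, so they become stationary, which means that iterated cycling raises the infimum. If
  \<open>q - p \<ge> 2\<close>, the conjugator for \<open>k\<close> slidings is the gcd of those for \<open>k\<close> cyclings and for \<open>k\<close>
  decyclings, and sliding raises the infimum as well. If \<open>q - p \<le> 1\<close>, then \<open>h 1 \<preceq> 1\<close>, and the same
  stationarity argument gives \<open>h 1 = 1\<close>. The supremum is treated by passing to \<open>z\<^sup>-\<^sup>1\<close>.\<close>

lemma carrier_left_order [simp]: "carrier (left_order G P) = carrier G"
  by (simp add: left_order_def)

lemma carrier_right_order [simp]: "carrier (right_order G P) = carrier G"
  by (simp add: right_order_def)

text \<open>With \<open>k0\<close> as witness and \<open>m\<close> as bound, the part of
  \<open>Q\<close> above \<open>k0\<close> is finite and nonempty, so its \<open>Max\<close> is the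
  value of \<open>GREATEST\<close>; downward closure then gives the equivalence.\<close>

lemma int_Greatest_iff:
  fixes Q :: "int \<Rightarrow> bool"
  assumes "Q k0" "\<And>k. Q k \<Longrightarrow> k \<le> m" "\<And>k l. Q k \<Longrightarrow> l \<le> k \<Longrightarrow> Q l"
  shows "k \<le> (GREATEST k. Q k) \<longleftrightarrow> Q k"
proof -
  let ?S = "{k. k0 \<le> k \<and> Q k}"
  have "finite ?S"
    using assms(2) by (auto intro: finite_subset[of _ "{k0..m}"])
  moreover have "k0 \<in> ?S"
    using assms(1) by simp
  ultimately have M: "Max ?S \<in> ?S" "\<And>k. k0 \<le> k \<Longrightarrow> Q k \<Longrightarrow> k \<le> Max ?S"
    using Max_in[of ?S] Max_ge[of ?S] by blast+
  have ge: "k \<le> Max ?S" if "Q k" for k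
    using M that by (cases "k0 \<le> k") auto
  have "(GREATEST k. Q k) = Max ?S"
    using M(1) ge by (intro Greatest_equality) auto
  then show ?thesis using M(1) ge assms(3) by auto
qed

section \<open>The lattice order and multiplication by powers of \<open>\<Delta>\<close>\<close>

locale nontrivial_garside_structure = garside_structure +
  assumes nontrivial: "carrier G \<noteq> {\<one>}"
begin

sublocale pos: submonoid P G
  by (rule positive_submonoid)

sublocale ord: lattice "left_order G P"
  by (rule left_lattice)

abbreviation left_le (infix "\<preceq>" 50) where
  "a \<preceq> b \<equiv> a \<sqsubseteq>\<^bsub>left_order G P\<^esub> b"

abbreviation left_gcd (infixl "\<and>\<^sub>G" 67) where
  "a \<and>\<^sub>G b \<equiv> a \<sqinter>\<^bsub>left_order G P\<^esub> b"

abbreviation left_lcm (infixl "\<or>\<^sub>G" 65) where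
  "a \<or>\<^sub>G b \<equiv> a \<squnion>\<^bsub>left_order G P\<^esub> b"

lemma le_iff: "a \<preceq> b \<longleftrightarrow> inv a \<otimes> b \<in> P"
  by (simp add: left_order_def)

lemmas le_refl = ord.le_refl[simplified]
lemmas le_trans = ord.le_trans[simplified]
lemmas le_antisym = ord.le_antisym[simplified]
lemmas gcd_closed [simp] = ord.meet_closed[simplified]
lemmas lcm_closed [simp] = ord.join_closed[simplified]
lemmas gcd_le1 = ord.meet_left[simplified]
lemmas gcd_le2 = ord.meet_right[simplified]
lemmas lcm_ge1 = ord.join_left[simplified]
lemmas lcm_ge2 = ord.join_right[simplified]

declare le_refl [simp]

lemma le_gcd_iff:
  assumes "a \<in> carrier G" "b \<in> carrier G" "c \<in> carrier G"
  shows "c \<preceq> a \<and>\<^sub>G b \<longleftrightarrow> c \<preceq> a \<and> c \<preceq> b"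
  using assms ord.meet_le[of c a b] gcd_le1[of a b] gcd_le2[of a b]
    le_trans[of c "a \<and>\<^sub>G b" a] le_trans[of c "a \<and>\<^sub>G b" b] by auto

lemma lcm_le_iff:
  assumes "a \<in> carrier G" "b \<in> carrier G" "c \<in> carrier G"
  shows "a \<or>\<^sub>G b \<preceq> c \<longleftrightarrow> a \<preceq> c \<and> b \<preceq> c"
  using assms ord.join_le[of a c b] lcm_ge1[of a b] lcm_ge2[of a b]
    le_trans[of a "a \<or>\<^sub>G b" c] le_trans[of b "a \<or>\<^sub>G b" c] by auto

lemma Delta_closed [simp, intro]: "\<Delta> \<in> carrier G"
  using Delta_positive pos.subset by blast

lemma positive_closed: "p \<in> P \<Longrightarrow> p \<in> carrier G"
  using pos.subset by blast

lemma positive_iff: "a \<in> carrier G \<Longrightarrow> a \<in> P \<longleftrightarrow> \<one> \<preceq> a"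
  by (simp add: le_iff)

lemma le_mult_left:
  assumes "g \<in> carrier G" "a \<in> carrier G" "b \<in> carrier G"
  shows "g \<otimes> a \<preceq> g \<otimes> b \<longleftrightarrow> a \<preceq> b"
proof -
  have "inv (g \<otimes> a) \<otimes> (g \<otimes> b) = inv a \<otimes> b"
    using assms by (simp add: inv_mult_group m_assoc) (simp add: m_assoc[symmetric])
  then show ?thesis by (simp add: le_iff)
qed

lemma conj_Delta_positive_iff:
  assumes "p \<in> carrier G"
  shows "inv \<Delta> \<otimes> p \<otimes> \<Delta> \<in> P \<longleftrightarrow> p \<in> P"
proof
  assume "inv \<Delta> \<otimes> p \<otimes> \<Delta> \<in> P"
  then obtain p' where "p' \<in> P" "inv \<Delta> \<otimes> p \<otimes> \<Delta> = inv \<Delta> \<otimes> p' \<otimes> \<Delta>"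
    using Delta_conj_positive by blast
  then show "p \<in> P"
    using assms positive_closed[of p'] by (simp add: m_assoc)
qed (use Delta_conj_positive in blast)

text \<open>Conjugation by \<open>\<Delta>\<close> maps \<open>P\<close> onto itself, so right
  multiplication by \<open>\<Delta>\<close> respects an order that is a priori only
  left-invariant.\<close>

lemma le_mult_Delta:
  assumes "a \<in> carrier G" "b \<in> carrier G"
  shows "a \<otimes> \<Delta> \<preceq> b \<otimes> \<Delta> \<longleftrightarrow> a \<preceq> b"
proof -
  have "inv (a \<otimes> \<Delta>) \<otimes> (b \<otimes> \<Delta>) = inv \<Delta> \<otimes> (inv a \<otimes> b) \<otimes> \<Delta>"
    using assms by (simp add: inv_mult_group m_assoc)
  then show ?thesis
    using assms conj_Delta_positive_iff[of "inv a \<otimes> b"] by (simp add: le_iff)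
qed

lemma Delta_pow_add: "\<Delta> [^] (k + l :: int) = \<Delta> [^] k \<otimes> \<Delta> [^] l"
  by (simp add: int_pow_mult)

lemma le_mult_Delta_pow:
  assumes "a \<in> carrier G" "b \<in> carrier G"
  shows "a \<otimes> \<Delta> [^] (k::int) \<preceq> b \<otimes> \<Delta> [^] k \<longleftrightarrow> a \<preceq> b"
proof (induction k rule: int_induct[where k = 0])
  case (step1 i)
  then show ?case
    using assms le_mult_Delta[of "a \<otimes> \<Delta> [^] i" "b \<otimes> \<Delta> [^] i"]
    by (simp add: Delta_pow_add m_assoc)
next
  case (step2 i)
  have "c \<otimes> \<Delta> [^] i = c \<otimes> \<Delta> [^] (i - 1) \<otimes> \<Delta>" if "c \<in> carrier G" for c
    using that Delta_pow_add[of "i - 1" 1] by (simp add: m_assoc)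
  then show ?case
    using step2 assms le_mult_Delta[of "a \<otimes> \<Delta> [^] (i - 1)" "b \<otimes> \<Delta> [^] (i - 1)"] by simp
qed (use assms in simp)

section \<open>Shifts as lattice automorphisms\<close>

text \<open>All maps occurring in the argument are of this form; they are automorphisms of the lattice.\<close>

definition shift :: "'a \<Rightarrow> int \<Rightarrow> 'a \<Rightarrow> 'a" where
  "shift u k a = u \<otimes> a \<otimes> \<Delta> [^] k"

lemma shift_closed [simp]: "\<lbrakk>u \<in> carrier G; a \<in> carrier G\<rbrakk> \<Longrightarrow> shift u k a \<in> carrier G"
  by (simp add: shift_def)

lemma shift_le_iff:
  "\<lbrakk>u \<in> carrier G; a \<in> carrier G; b \<in> carrier G\<rbrakk> \<Longrightarrow> shift u k a \<preceq> shift u k b \<longleftrightarrow> a \<preceq> b"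
  by (simp add: shift_def le_mult_Delta_pow le_mult_left)

lemma shift_shift:
  "\<lbrakk>u \<in> carrier G; v \<in> carrier G; a \<in> carrier G\<rbrakk> \<Longrightarrow> shift u k (shift v l a) = shift (u \<otimes> v) (l + k) a"
  by (simp add: shift_def m_assoc Delta_pow_add)

lemma shift_one_zero [simp]: "a \<in> carrier G \<Longrightarrow> shift \<one> 0 a = a"
  by (simp add: shift_def)

lemma shift_inverse:
  "\<lbrakk>u \<in> carrier G; a \<in> carrier G\<rbrakk> \<Longrightarrow> shift u k (shift (inv u) (- k) a) = a"
  by (simp add: shift_shift)

lemma shift_le_swap:
  assumes "u \<in> carrier G" "a \<in> carrier G" "b \<in> carrier G"
  shows "shift u k a \<preceq> b \<longleftrightarrow> a \<preceq> shift (inv u) (- k) b"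
  using assms shift_le_iff[of u a "shift (inv u) (- k) b" k] by (simp add: shift_inverse)

lemma le_shift_swap:
  assumes "u \<in> carrier G" "a \<in> carrier G" "b \<in> carrier G"
  shows "b \<preceq> shift u k a \<longleftrightarrow> shift (inv u) (- k) b \<preceq> a"
  using assms shift_le_iff[of u "shift (inv u) (- k) b" a k] by (simp add: shift_inverse)

lemma shift_gcd:
  assumes "u \<in> carrier G" "a \<in> carrier G" "b \<in> carrier G"
  shows "shift u k (a \<and>\<^sub>G b) = shift u k a \<and>\<^sub>G shift u k b"
proof (rule le_antisym)
  show "shift u k a \<and>\<^sub>G shift u k b \<preceq> shift u k (a \<and>\<^sub>G b)"
    using assms by (simp add: le_shift_swap le_gcd_iff) (simp add: le_shift_swap[symmetric] gcd_le1 gcd_le2)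
qed (use assms in \<open>simp_all add: le_gcd_iff shift_le_iff gcd_le1 gcd_le2\<close>)

lemma shift_lcm:
  assumes "u \<in> carrier G" "a \<in> carrier G" "b \<in> carrier G"
  shows "shift u k (a \<or>\<^sub>G b) = shift u k a \<or>\<^sub>G shift u k b"
proof (rule le_antisym)
  show "shift u k (a \<or>\<^sub>G b) \<preceq> shift u k a \<or>\<^sub>G shift u k b"
    using assms by (simp add: shift_le_swap lcm_le_iff) (simp add: shift_le_swap[symmetric] lcm_ge1 lcm_ge2)
qed (use assms in \<open>simp_all add: lcm_le_iff shift_le_iff lcm_ge1 lcm_ge2\<close>)

text \<open>Post-fixed points of a lattice automorphism form a sublattice; this is the convexity
  argument for super summit sets.\<close>

lemma gcd_le_shift:
  assumes "u \<in> carrier G" "a \<in> carrier G" "b \<in> carrier G"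
    and "a \<preceq> shift u k a" "b \<preceq> shift u k b"
  shows "a \<and>\<^sub>G b \<preceq> shift u k (a \<and>\<^sub>G b)"
  using assms by (simp add: shift_gcd le_gcd_iff) (metis gcd_le1 gcd_le2 le_trans shift_closed gcd_closed)

lemma lcm_le_shift:
  assumes "u \<in> carrier G" "a \<in> carrier G" "b \<in> carrier G"
    and "a \<preceq> shift u k a" "b \<preceq> shift u k b"
  shows "a \<or>\<^sub>G b \<preceq> shift u k (a \<or>\<^sub>G b)"
  using assms by (simp add: shift_lcm lcm_le_iff) (metis lcm_ge1 lcm_ge2 le_trans shift_closed lcm_closed)

text \<open>Powers of \<open>\<Delta>\<close> on the right commute, so commuting left factors make
  the two shifts commute, and one carries post-fixed points of the other to post-fixed
  points.\<close>

lemma le_shift_shift: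
  assumes "u \<in> carrier G" "v \<in> carrier G" "a \<in> carrier G" "u \<otimes> v = v \<otimes> u" "a \<preceq> shift u k a"
  shows "shift v l a \<preceq> shift u k (shift v l a)"
proof -
  have "shift u k (shift v l a) = shift v l (shift u k a)"
    using assms by (simp add: shift_shift add.commute)
  then show ?thesis
    using assms by (simp add: shift_le_iff)
qed

section \<open>Powers of \<open>\<Delta>\<close>, infimum and supremum\<close>

lemma Delta_pow_nonneg_positive: "0 \<le> k \<Longrightarrow> \<Delta> [^] (k::int) \<in> P"
proof (induction k rule: int_ge_induct)
  case (step i)
  then show ?case using Delta_positive by (simp add: Delta_pow_add)
qed simp

lemma Delta_pow_mono:
  assumes "k \<le> l" shows "\<Delta> [^] (k::int) \<preceq> \<Delta> [^] l"
proof -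
  have "inv (\<Delta> [^] k) \<otimes> \<Delta> [^] l = \<Delta> [^] (l - k)"
    using Delta_pow_add[of "- k" l] by (simp add: int_pow_neg)
  then show ?thesis using assms by (simp add: le_iff Delta_pow_nonneg_positive)
qed

text \<open>If \<open>\<Delta>\<close> were 1, antisymmetry would leave 1 as the only simple
  element, and the simple elements generate the group. Nontriviality enters here; it keeps the
  powers of \<open>\<Delta>\<close> distinct, so that infimum and supremum exist.\<close>

lemma Delta_neq_one: "\<Delta> \<noteq> \<one>"
proof
  assume "\<Delta> = \<one>"
  then have "simple_elements G P \<Delta> \<subseteq> {\<one>}"
    using le_antisym[of _ \<one>] by (auto simp: simple_elements_def at_least_at_most_def)
  then have "generate G (simple_elements G P \<Delta>) \<subseteq> generate G {\<one>}"
    by (rule mono_generate)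
  then show False
    using simple_generate nontrivial generate_one by auto
qed

lemma Delta_pow_le_imp_le:
  assumes "\<Delta> [^] (k::int) \<preceq> \<Delta> [^] l" shows "k \<le> l"
proof (rule ccontr)
  assume "\<not> k \<le> l"
  then have "\<Delta> [^] k \<preceq> \<Delta> [^] (k - 1)"
    using le_trans[OF assms Delta_pow_mono[of l "k - 1"]] by simp
  then have "\<Delta> [^] (k - 1) = \<Delta> [^] (k - 1) \<otimes> \<Delta>"
    using le_antisym[OF _ Delta_pow_mono[of "k - 1" k]] Delta_pow_add[of "k - 1" 1] by simp
  then show False
    using Delta_neq_one r_cancel_one'[of "\<Delta> [^] (k - 1)" \<Delta>] by simp
qed

text \<open>Simple elements lie between exponents 0 and 1, their inverses between -1 and 0, and
  under products the exponents of the bounds add up.\<close>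

lemma Delta_pow_bounds:
  assumes "x \<in> carrier G"
  obtains k l :: int where "\<Delta> [^] k \<preceq> x" "x \<preceq> \<Delta> [^] l"
proof -
  have "x \<in> generate G (simple_elements G P \<Delta>)"
    using assms simple_generate by simp
  then have "x \<in> carrier G \<and> (\<exists>(k::int) (l::int). \<Delta> [^] k \<preceq> x \<and> x \<preceq> \<Delta> [^] l)"
  proof (induction rule: generate.induct)
    case one
    then show ?case by (intro conjI exI[of _ 0]) simp_all
  next
    case (incl h)
    then have "h \<in> carrier G" "\<Delta> [^] (0::int) \<preceq> h" "h \<preceq> \<Delta> [^] (1::int)"
      by (simp_all add: simple_elements_def at_least_at_most_def)
    then show ?case by blast
  next
    case (inv h)
    then have h: "h \<in> carrier G" "\<one> \<preceq> h" "h \<preceq> \<Delta>"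
      by (simp_all add: simple_elements_def at_least_at_most_def)
    have "inv h \<preceq> \<Delta> [^] (0::int)"
      using h le_mult_left[of "inv h" \<one> h] by simp
    moreover have "\<Delta> [^] (- 1::int) \<preceq> inv h"
    proof -
      have "inv h \<otimes> h \<otimes> \<Delta> [^] (- 1::int) \<preceq> inv h \<otimes> \<Delta> \<otimes> \<Delta> [^] (- 1::int)"
        using h by (simp only: le_mult_Delta_pow le_mult_left inv_closed m_closed Delta_closed)
      then show ?thesis using h by (simp add: m_assoc int_pow_neg)
    qed
    ultimately show ?case using h by blast
  next
    case (eng a b)
    then obtain k l k' l' :: int where
      a: "a \<in> carrier G" "\<Delta> [^] k \<preceq> a" "a \<preceq> \<Delta> [^] l" and
      b: "b \<in> carrier G" "\<Delta> [^] k' \<preceq> b" "b \<preceq> \<Delta> [^] l'" by blast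
    have "\<Delta> [^] k \<otimes> \<Delta> [^] k' \<preceq> a \<otimes> \<Delta> [^] k'" "a \<otimes> \<Delta> [^] k' \<preceq> a \<otimes> b"
      "a \<otimes> b \<preceq> a \<otimes> \<Delta> [^] l'" "a \<otimes> \<Delta> [^] l' \<preceq> \<Delta> [^] l \<otimes> \<Delta> [^] l'"
      using a b by (simp_all only: le_mult_Delta_pow le_mult_left int_pow_closed Delta_closed)
    then have "\<Delta> [^] (k + k') \<preceq> a \<otimes> b" "a \<otimes> b \<preceq> \<Delta> [^] (l + l')"
      using a b le_trans[of "\<Delta> [^] k \<otimes> \<Delta> [^] k'" "a \<otimes> \<Delta> [^] k'" "a \<otimes> b"]
        le_trans[of "a \<otimes> b" "a \<otimes> \<Delta> [^] l'" "\<Delta> [^] l \<otimes> \<Delta> [^] l'"]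
      by (simp_all add: Delta_pow_add)
    then show ?case using a b by blast
  qed
  then show ?thesis using that by blast
qed

lemma le_garside_inf_iff:
  assumes "x \<in> carrier G"
  shows "k \<le> garside_inf G P \<Delta> x \<longleftrightarrow> \<Delta> [^] k \<preceq> x"
proof -
  obtain k0 l0 :: int where b: "\<Delta> [^] k0 \<preceq> x" "x \<preceq> \<Delta> [^] l0"
    using Delta_pow_bounds assms by blast
  show ?thesis unfolding garside_inf_def
  proof (rule int_Greatest_iff[where Q = "\<lambda>k. \<Delta> [^] k \<preceq> x", OF b(1)])
    fix k :: int assume "\<Delta> [^] k \<preceq> x"
    then show "k \<le> l0"
      using assms b(2) by (intro Delta_pow_le_imp_le) (auto intro: le_trans)
  next
    fix k l :: int assume "\<Delta> [^] k \<preceq> x" "l \<le> k"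
    then show "\<Delta> [^] l \<preceq> x"
      using assms le_trans[OF Delta_pow_mono] by simp
  qed
qed

lemma Delta_pow_le_inv_iff:
  assumes "x \<in> carrier G"
  shows "\<Delta> [^] (- k) \<preceq> inv x \<longleftrightarrow> x \<preceq> \<Delta> [^] (k::int)"
proof -
  have "\<Delta> [^] (- k) \<preceq> inv x \<longleftrightarrow> shift x k (\<Delta> [^] (- k)) \<preceq> shift x k (inv x)"
    using assms by (simp add: shift_le_iff)
  then show ?thesis
    using assms by (simp add: shift_def m_assoc int_pow_neg)
qed

text \<open>Inversion exchanges lower and upper bounds by powers of \<open>\<Delta>\<close>. Through
  this, facts about the supremum follow from facts about the infimum of the inverse.\<close>

lemma garside_inf_inv:
  assumes "x \<in> carrier G"
  shows "garside_inf G P \<Delta> (inv x) = - garside_sup G P \<Delta> x"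
proof -
  define m where "m = garside_inf G P \<Delta> (inv x)"
  have "x \<preceq> \<Delta> [^] k \<longleftrightarrow> - m \<le> k" for k
    using assms le_garside_inf_iff[of "inv x" "- k"] Delta_pow_le_inv_iff[of x k] by (auto simp: m_def)
  then have "garside_sup G P \<Delta> x = - m"
    unfolding garside_sup_def by (intro Least_equality) auto
  then show ?thesis by (simp add: m_def)
qed

lemma garside_sup_inv:
  "x \<in> carrier G \<Longrightarrow> garside_sup G P \<Delta> (inv x) = - garside_inf G P \<Delta> x"
  using garside_inf_inv[of "inv x"] by simp

section \<open>Conjugation and the infimum of conjugates\<close>

lemma conjugate_closed [simp]:
  "\<lbrakk>x \<in> carrier G; c \<in> carrier G\<rbrakk> \<Longrightarrow> conjugate G x c \<in> carrier G"
  by (simp add: conjugate_def)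

lemma conjugate_one [simp]: "x \<in> carrier G \<Longrightarrow> conjugate G x \<one> = x"
  by (simp add: conjugate_def)

lemma conjugate_conjugate:
  "\<lbrakk>x \<in> carrier G; c \<in> carrier G; d \<in> carrier G\<rbrakk> \<Longrightarrow>
    conjugate G (conjugate G x c) d = conjugate G x (c \<otimes> d)"
  by (simp add: conjugate_def inv_mult_group m_assoc)

lemma inv_conjugate:
  "\<lbrakk>x \<in> carrier G; c \<in> carrier G\<rbrakk> \<Longrightarrow> inv (conjugate G x c) = conjugate G (inv x) c"
  by (simp add: conjugate_def inv_mult_group m_assoc)

lemma mult_conjugate:
  "\<lbrakk>x \<in> carrier G; c \<in> carrier G\<rbrakk> \<Longrightarrow> c \<otimes> conjugate G x c = x \<otimes> c"
  by (simp add: conjugate_def m_assoc[symmetric])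

text \<open>Multiply by \<open>a\<close> on the left and by the inverse power of
  \<open>\<Delta>\<close> on the right. A bound on the infimum thereby says that the conjugator is a
  post-fixed point of a shift depending on \<open>z\<close> and \<open>k\<close> only.\<close>

lemma le_garside_inf_conjugate_iff:
  assumes "z \<in> carrier G" "a \<in> carrier G"
  shows "k \<le> garside_inf G P \<Delta> (conjugate G z a) \<longleftrightarrow> a \<preceq> shift z (- k) a"
proof -
  have "k \<le> garside_inf G P \<Delta> (conjugate G z a)
      \<longleftrightarrow> shift a (- k) (\<Delta> [^] k) \<preceq> shift a (- k) (conjugate G z a)"
    using assms by (simp add: le_garside_inf_iff shift_le_iff)
  also have "shift a (- k) (\<Delta> [^] k) = a"
    using assms by (simp add: shift_def m_assoc int_pow_neg)
  also have "shift a (- k) (conjugate G z a) = shift z (- k) a"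
    using assms by (simp add: shift_def mult_conjugate)
  finally show ?thesis .
qed

lemma garside_sup_conjugate_le_iff:
  assumes "z \<in> carrier G" "a \<in> carrier G"
  shows "garside_sup G P \<Delta> (conjugate G z a) \<le> k \<longleftrightarrow> a \<preceq> shift (inv z) k a"
  using assms le_garside_inf_conjugate_iff[of "inv z" a "- k"]
  by (simp add: inv_conjugate[symmetric] garside_inf_inv)

section \<open>Preferred prefixes and cyclic sliding\<close>

lemma gcd_leI1:
  "\<lbrakk>a \<preceq> c; a \<in> carrier G; b \<in> carrier G; c \<in> carrier G\<rbrakk> \<Longrightarrow> a \<and>\<^sub>G b \<preceq> c"
  using le_trans[OF gcd_le1] by simp

lemma gcd_leI2:
  "\<lbrakk>b \<preceq> c; a \<in> carrier G; b \<in> carrier G; c \<in> carrier G\<rbrakk> \<Longrightarrow> a \<and>\<^sub>G b \<preceq> c"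
  using le_trans[OF gcd_le2] by simp

lemma shift_mono_exponent:
  assumes "u \<in> carrier G" "a \<in> carrier G" "k \<le> l"
  shows "shift u k a \<preceq> shift u l a"
  using assms by (simp add: shift_def le_mult_left Delta_pow_mono)

text \<open>Left multiplication distributes over gcds, and \<open>a\<close> times the conjugate of
  \<open>z\<close> by \<open>a\<close> is \<open>z \<otimes> a\<close>. The conjugator after one
  more sliding is thus expressed by shifts built from \<open>z\<close> itself.\<close>

lemma mult_preferred_prefix_conjugate:
  assumes "z \<in> carrier G" "a \<in> carrier G"
  shows "a \<otimes> preferred_prefix G P \<Delta> (conjugate G z a) =
    shift z (- garside_inf G P \<Delta> (conjugate G z a)) a
    \<and>\<^sub>G shift (inv z) (garside_sup G P \<Delta> (conjugate G z a)) a \<and>\<^sub>G shift \<one> 1 a"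
proof -
  let ?w = "conjugate G z a"
  have "a \<otimes> preferred_prefix G P \<Delta> ?w = shift a 0 (preferred_prefix G P \<Delta> ?w)"
    using assms by (simp add: shift_def preferred_prefix_def)
  also have "\<dots> = a \<otimes> ?w \<otimes> \<Delta> [^] (- garside_inf G P \<Delta> ?w)
      \<and>\<^sub>G a \<otimes> inv ?w \<otimes> \<Delta> [^] garside_sup G P \<Delta> ?w \<and>\<^sub>G a \<otimes> \<Delta>"
    using assms by (simp add: preferred_prefix_def shift_gcd) (simp add: shift_def m_assoc)
  finally show ?thesis
    using assms by (simp add: shift_def inv_conjugate mult_conjugate)
qed

lemma preferred_prefix_eq:
  "z \<in> carrier G \<Longrightarrow> preferred_prefix G P \<Delta> z =
    shift z (- garside_inf G P \<Delta> z) \<one> \<and>\<^sub>G shift (inv z) (garside_sup G P \<Delta> z) \<one> \<and>\<^sub>G shift \<one> 1 \<one>"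
  using mult_preferred_prefix_conjugate[of z \<one>] by (simp add: preferred_prefix_def)

lemma preferred_prefix_closed [simp]:
  "z \<in> carrier G \<Longrightarrow> preferred_prefix G P \<Delta> z \<in> carrier G"
  by (simp add: preferred_prefix_eq)

lemma preferred_prefix_inv:
  "z \<in> carrier G \<Longrightarrow> preferred_prefix G P \<Delta> (inv z) = preferred_prefix G P \<Delta> z"
  by (simp add: preferred_prefix_eq garside_inf_inv garside_sup_inv meet_comm)

lemma cyclic_sliding_closed [simp]:
  "z \<in> carrier G \<Longrightarrow> cyclic_sliding G P \<Delta> z \<in> carrier G"
  by (simp add: cyclic_sliding_def)

lemma cyclic_sliding_inv:
  "z \<in> carrier G \<Longrightarrow> cyclic_sliding G P \<Delta> (inv z) = inv (cyclic_sliding G P \<Delta> z)"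
  by (simp add: cyclic_sliding_def preferred_prefix_inv inv_conjugate)

lemma sliding_iter_closed [simp]:
  "z \<in> carrier G \<Longrightarrow> (cyclic_sliding G P \<Delta> ^^ k) z \<in> carrier G"
  by (induction k) simp_all

lemma sliding_iter_inv:
  "z \<in> carrier G \<Longrightarrow> (cyclic_sliding G P \<Delta> ^^ k) (inv z) = inv ((cyclic_sliding G P \<Delta> ^^ k) z)"
  by (induction k) (simp_all add: cyclic_sliding_inv)

text \<open>The preferred prefix is a gcd of shifts of 1 that commute with
  \<open>shift z (- ?p)\<close>; 1 is a post-fixed point of the latter, hence so are these shifts
  and their gcd.\<close>

lemma garside_inf_cyclic_sliding_ge:
  assumes z: "z \<in> carrier G"
  shows "garside_inf G P \<Delta> z \<le> garside_inf G P \<Delta> (cyclic_sliding G P \<Delta> z)"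
proof -
  let ?p = "garside_inf G P \<Delta> z"
  have "\<one> \<preceq> shift z (- ?p) \<one>"
    using z le_garside_inf_conjugate_iff[of z \<one> ?p] by simp
  then have "shift v k \<one> \<preceq> shift z (- ?p) (shift v k \<one>)" if "v \<in> carrier G" "z \<otimes> v = v \<otimes> z" for v k
    using z that by (intro le_shift_shift) simp_all
  then show ?thesis
    using z by (simp add: cyclic_sliding_def le_garside_inf_conjugate_iff preferred_prefix_eq gcd_le_shift)
qed

text \<open>The finiteness of the norm enters the argument only here.\<close>

lemma decreasing_chain_stationary:
  assumes f: "\<And>n. f n \<in> carrier G" "\<And>n::nat. f (Suc n) \<preceq> f n"
    and a: "a \<in> carrier G" "\<And>n. a \<preceq> f n"
  shows "\<exists>n. f (Suc n) = f n"
proof (rule ccontr)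
  assume "\<nexists>n. f (Suc n) = f n"
  then have ne: "f (Suc n) \<noteq> f n" for n by blast
  let ?x = "inv a \<otimes> f 0"
  have step: "inv c \<otimes> d \<in> P - {\<one>}" if "c \<preceq> d" "c \<noteq> d" "c \<in> carrier G" "d \<in> carrier G" for c d
    using that by (simp add: le_iff) (metis inv_inv inv_equality inv_closed)
  \<comment> \<open>The quotients of consecutive terms of \<open>f\<close> are nontrivial positive
    factors.\<close>
  have "\<exists>as. set as \<subseteq> P - {\<one>} \<and> length as = n \<and> inv (f n) \<otimes> f 0 = foldr (\<otimes>) as \<one>" for n
  proof (induction n)
    case 0
    then show ?case using f by simp
  next
    case (Suc n)
    then obtain as where as: "set as \<subseteq> P - {\<one>}" "length as = n" "inv (f n) \<otimes> f 0 = foldr (\<otimes>) as \<one>"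
      by blast
    have "inv (f (Suc n)) \<otimes> f n \<otimes> (inv (f n) \<otimes> f 0) = inv (f (Suc n)) \<otimes> f 0"
      using f(1) by (metis inv_closed m_assoc m_closed r_inv r_one)
    then show ?case
      using as step[OF f(2) ne f(1) f(1), of n]
      by (intro exI[of _ "inv (f (Suc n)) \<otimes> f n # as"]) simp
  qed
  \<comment> \<open>A chain reaching its lower bound \<open>a\<close> could not strictly decrease
    further. The quotient of \<open>a\<close> and \<open>f n\<close> is therefore one more
    nontrivial factor, and \<open>?x\<close> has factorizations of every positive length.\<close>
  moreover have ne_a: "a \<noteq> f n" for n
    using le_antisym[OF f(2) _ f(1) f(1)] a ne[of n] by metis
  moreover have "inv a \<otimes> f n \<otimes> (inv (f n) \<otimes> f 0) = ?x" for n
    using f(1) a(1) by (metis inv_closed m_assoc m_closed r_inv r_one)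
  ultimately have "\<exists>as. set as \<subseteq> P - {\<one>} \<and> length as = Suc n \<and> ?x = foldr (\<otimes>) as \<one>" for n
    using step[OF a(2) ne_a a(1) f(1), of n]
    by (metis (no_types, lifting) foldr.simps(2) insert_subset length_Cons list.simps(15) comp_apply)
  then have "enat (Suc n) \<le> garside_norm G P ?x" for n
    unfolding garside_norm_def by (intro Sup_upper) (smt (verit) mem_Collect_eq)
  moreover have "garside_norm G P ?x < \<infinity>"
    using step[OF a(2) ne_a a(1) f(1)] by (rule norm_finite)
  ultimately show False
    by (metis Suc_n_not_le_n enat_ord_simps(1) less_infinityE)
qed

section \<open>Iterated cycling, decycling and sliding\<close>

text \<open>With \<open>p = garside_inf G P \<Delta> z\<close>, the element \<open>cycling_conjugator z p k\<close> conjugates \<open>z\<close> to its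
  \<open>k\<close>-fold cycling as long as the infimum stays equal to \<open>p\<close>, and \<open>cycling_conjugator (inv z) (- q) k\<close>
  plays the same role for decycling.\<close>

definition cycling_conjugator :: "'a \<Rightarrow> int \<Rightarrow> nat \<Rightarrow> 'a" where
  "cycling_conjugator z p k = ((\<lambda>c. shift z (- p) c \<and>\<^sub>G shift \<one> 1 c) ^^ k) \<one>"

text \<open>The exponents are fixed parameters, not recomputed at each step; this yields the
  conjugator for \<open>k\<close> slidings as long as infimum and supremum stay equal to
  \<open>p\<close> and \<open>q\<close>.\<close>

definition sliding_conjugator :: "'a \<Rightarrow> int \<Rightarrow> int \<Rightarrow> nat \<Rightarrow> 'a" where
  "sliding_conjugator z p q k = ((\<lambda>c. shift z (- p) c \<and>\<^sub>G shift (inv z) q c \<and>\<^sub>G shift \<one> 1 c) ^^ k) \<one>"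

lemma cycling_conjugator_0 [simp]: "cycling_conjugator z p 0 = \<one>"
  by (simp add: cycling_conjugator_def)

lemma cycling_conjugator_Suc:
  "cycling_conjugator z p (Suc k) =
    shift z (- p) (cycling_conjugator z p k) \<and>\<^sub>G shift \<one> 1 (cycling_conjugator z p k)"
  by (simp add: cycling_conjugator_def)

lemma sliding_conjugator_0 [simp]: "sliding_conjugator z p q 0 = \<one>"
  by (simp add: sliding_conjugator_def)

lemma sliding_conjugator_Suc:
  "sliding_conjugator z p q (Suc k) =
    shift z (- p) (sliding_conjugator z p q k)
    \<and>\<^sub>G shift (inv z) q (sliding_conjugator z p q k)
    \<and>\<^sub>G shift \<one> 1 (sliding_conjugator z p q k)"
  by (simp add: sliding_conjugator_def)

lemma cycling_conjugator_closed [simp]: "z \<in> carrier G \<Longrightarrow> cycling_conjugator z p k \<in> carrier G"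
  by (induction k) (simp_all add: cycling_conjugator_Suc)

lemma sliding_conjugator_closed [simp]: "z \<in> carrier G \<Longrightarrow> sliding_conjugator z p q k \<in> carrier G"
  by (induction k) (simp_all add: sliding_conjugator_Suc)

lemma sliding_iter_eq_conjugate:
  assumes z: "z \<in> carrier G"
    and "\<And>k. garside_inf G P \<Delta> ((cyclic_sliding G P \<Delta> ^^ k) z) = p"
    and "\<And>k. garside_sup G P \<Delta> ((cyclic_sliding G P \<Delta> ^^ k) z) = q"
  shows "(cyclic_sliding G P \<Delta> ^^ k) z = conjugate G z (sliding_conjugator z p q k)"
proof (induction k)
  case (Suc k)
  let ?c = "sliding_conjugator z p q k"
  have "(cyclic_sliding G P \<Delta> ^^ Suc k) z
      = conjugate G z (?c \<otimes> preferred_prefix G P \<Delta> (conjugate G z ?c))"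
    using z Suc cyclic_sliding_def[of G P \<Delta> "(cyclic_sliding G P \<Delta> ^^ k) z"]
    by (simp add: conjugate_conjugate)
  also have "?c \<otimes> preferred_prefix G P \<Delta> (conjugate G z ?c) = sliding_conjugator z p q (Suc k)"
    using z Suc assms(2,3)[of k] by (simp add: mult_preferred_prefix_conjugate sliding_conjugator_Suc)
  finally show ?case .
qed (use z in simp)

lemma sliding_conjugator_le_cyc:
  assumes z: "z \<in> carrier G"
  shows "sliding_conjugator z p q k \<preceq> cycling_conjugator z p k"
proof (induction k)
  case (Suc k)
  then have "shift z (- p) (sliding_conjugator z p q k) \<preceq> shift z (- p) (cycling_conjugator z p k)"
    "shift \<one> 1 (sliding_conjugator z p q k) \<preceq> shift \<one> 1 (cycling_conjugator z p k)"
    using z by (simp_all add: shift_le_iff)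
  then show ?case
    using z by (simp add: sliding_conjugator_Suc cycling_conjugator_Suc le_gcd_iff gcd_leI1 gcd_leI2)
qed simp

lemma sliding_conjugator_inv: "z \<in> carrier G \<Longrightarrow> sliding_conjugator (inv z) (- q) (- p) k = sliding_conjugator z p q k"
  by (induction k) (simp_all add: sliding_conjugator_Suc meet_comm)

lemma sliding_conjugator_le_decyc:
  "z \<in> carrier G \<Longrightarrow> sliding_conjugator z p q k \<preceq> cycling_conjugator (inv z) (- q) k"
  using sliding_conjugator_le_cyc[of "inv z" "- q" "- p" k] by (simp add: sliding_conjugator_inv)

lemma cycling_conjugator_le_Delta_pow:
  assumes z: "z \<in> carrier G"
  shows "cycling_conjugator z p k \<preceq> shift \<one> (int k) \<one>"
proof (induction k)
  case (Suc k)
  then have "shift \<one> 1 (cycling_conjugator z p k) \<preceq> shift \<one> 1 (shift \<one> (int k) \<one>)"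
    using z by (simp add: shift_le_iff)
  then show ?case
    using z by (simp add: cycling_conjugator_Suc shift_shift add.commute gcd_leI2)
qed simp

lemma cycling_conjugator_Suc_le:
  assumes z: "z \<in> carrier G"
  shows "cycling_conjugator z p (Suc k) \<preceq> shift z (int k - p) \<one>"
proof -
  have "shift z (- p) (cycling_conjugator z p k) \<preceq> shift z (- p) (shift \<one> (int k) \<one>)"
    using z cycling_conjugator_le_Delta_pow by (simp add: shift_le_iff)
  then show ?thesis
    using z by (simp add: cycling_conjugator_Suc shift_shift gcd_leI1)
qed

text \<open>Since \<open>shift z (- p)\<close> and \<open>shift (inv z) q\<close> compose to multiplication by \<open>\<Delta> [^] (q - p)\<close>,
  mixed terms are dominated as soon as the canonical length \<open>q - p\<close> is at least 2.\<close>

lemma shift_decyc_ge: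
  assumes z: "z \<in> carrier G" and pq: "p + 2 \<le> q"
  shows "shift z (int k - p) \<one> \<and>\<^sub>G shift \<one> 1 (cycling_conjugator (inv z) (- q) k)
    \<preceq> shift z (- p) (cycling_conjugator (inv z) (- q) k)"
proof (induction k)
  case 0
  then show ?case using z by (simp add: gcd_le1)
next
  case (Suc k)
  let ?D = "cycling_conjugator (inv z) (- q) k"
  let ?X = "shift z (int (Suc k) - p) \<one>" and ?Y = "shift \<one> 1 (cycling_conjugator (inv z) (- q) (Suc k))"
  have Y: "?Y \<preceq> shift \<one> 2 ?D"
    using z by (simp add: cycling_conjugator_Suc shift_gcd shift_shift gcd_le2)
  \<comment> \<open>This handles the first term in the recursion for the decycling conjugator: its
    image under \<open>shift z (- p)\<close> is \<open>shift \<one> (q - p) ?D\<close>, and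
    \<open>q - p\<close> is at least 2.\<close>
  have "?X \<and>\<^sub>G ?Y \<preceq> shift \<one> (q - p) ?D"
    using z pq le_trans[OF Y shift_mono_exponent[of \<one> ?D 2 "q - p"]] by (simp add: gcd_leI2)
  then have 1: "?X \<and>\<^sub>G ?Y \<preceq> shift z (- p) (shift (inv z) q ?D)"
    using z by (simp add: shift_shift)
  \<comment> \<open>The second term of the recursion comes from the induction hypothesis, shifted by
    one more \<open>\<Delta>\<close>.\<close>
  have "shift \<one> 1 (shift z (int k - p) \<one> \<and>\<^sub>G shift \<one> 1 ?D) \<preceq> shift \<one> 1 (shift z (- p) ?D)"
    using z Suc by (simp add: shift_le_iff)
  then have "?X \<and>\<^sub>G shift \<one> 2 ?D \<preceq> shift z (1 - p) ?D"
    using z by (simp add: shift_gcd shift_shift algebra_simps)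
  moreover have "?X \<and>\<^sub>G ?Y \<preceq> ?X \<and>\<^sub>G shift \<one> 2 ?D"
    using z Y by (simp add: le_gcd_iff gcd_leI2 gcd_le1 del: of_nat_Suc)
  ultimately have 2: "?X \<and>\<^sub>G ?Y \<preceq> shift z (- p) (shift \<one> 1 ?D)"
    using z le_trans[of "?X \<and>\<^sub>G ?Y" "?X \<and>\<^sub>G shift \<one> 2 ?D" "shift z (1 - p) ?D"]
    by (simp add: shift_shift del: of_nat_Suc)
  show ?case
    using z 1 2 by (simp add: cycling_conjugator_Suc[of _ _ k] shift_gcd le_gcd_iff)
qed

lemma cycling_conjugator_gcd_decyc_le_shift:
  assumes z: "z \<in> carrier G" and pq: "p + 2 \<le> q"
  shows "cycling_conjugator z p (Suc k) \<and>\<^sub>G cycling_conjugator (inv z) (- q) (Suc k)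
    \<preceq> shift z (- p) (cycling_conjugator (inv z) (- q) k)"
proof -
  let ?D = "cycling_conjugator (inv z) (- q)"
  have "?D (Suc k) \<preceq> shift \<one> 1 (?D k)"
    using z by (simp add: cycling_conjugator_Suc gcd_le2)
  then have "cycling_conjugator z p (Suc k) \<and>\<^sub>G ?D (Suc k) \<preceq> shift z (int k - p) \<one> \<and>\<^sub>G shift \<one> 1 (?D k)"
    using z cycling_conjugator_Suc_le[of z p k] by (simp add: le_gcd_iff gcd_leI1 gcd_leI2)
  then show ?thesis
    using z le_trans[OF _ shift_decyc_ge[OF z pq]] by simp
qed

text \<open>With \<open>sliding_conjugator_le_cyc\<close> and
  \<open>sliding_conjugator_le_decyc\<close>, this makes the sliding conjugator the gcd of the other
  two. Three shifts applied to the gcd of two elements give six terms: four occur in the recursions,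
  and the two mixed ones are bounded by \<open>cycling_conjugator_gcd_decyc_le_shift\<close> for
  \<open>z\<close> and for its inverse.\<close>

lemma cycling_conjugator_gcd_decyc_le_sld:
  assumes z: "z \<in> carrier G" and pq: "p + 2 \<le> q"
  shows "cycling_conjugator z p k \<and>\<^sub>G cycling_conjugator (inv z) (- q) k \<preceq> sliding_conjugator z p q k"
proof (induction k)
  case 0
  then show ?case by (simp add: gcd_le1)
next
  case (Suc k)
  let ?C = "cycling_conjugator z p" and ?D = "cycling_conjugator (inv z) (- q)" and ?E = "sliding_conjugator z p q"
  let ?M = "?C (Suc k) \<and>\<^sub>G ?D (Suc k)"
  have M: "?M \<preceq> shift u l (?E k)"
    if "u \<in> carrier G" "?M \<preceq> shift u l (?C k)" "?M \<preceq> shift u l (?D k)" for u l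
  proof -
    have "?M \<preceq> shift u l (?C k \<and>\<^sub>G ?D k)"
      using z that by (simp add: shift_gcd le_gcd_iff)
    moreover have "shift u l (?C k \<and>\<^sub>G ?D k) \<preceq> shift u l (?E k)"
      using z Suc that by (simp add: shift_le_iff)
    ultimately show ?thesis
      using z that le_trans[of ?M "shift u l (?C k \<and>\<^sub>G ?D k)" "shift u l (?E k)"] by simp
  qed
  have C: "?C (Suc k) \<preceq> shift z (- p) (?C k)" "?C (Suc k) \<preceq> shift \<one> 1 (?C k)"
    using z by (simp_all add: cycling_conjugator_Suc gcd_le1 gcd_le2)
  have D: "?D (Suc k) \<preceq> shift (inv z) q (?D k)" "?D (Suc k) \<preceq> shift \<one> 1 (?D k)"
    using z by (simp_all add: cycling_conjugator_Suc gcd_le1 gcd_le2)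
  have "?M \<preceq> shift z (- p) (?E k)"
    using z C cycling_conjugator_gcd_decyc_le_shift[OF z pq] by (intro M) (simp_all add: gcd_leI1)
  moreover have "?M \<preceq> shift (inv z) q (?C k)"
    using z cycling_conjugator_gcd_decyc_le_shift[of "inv z" "- q" "- p" k] pq
    by (simp add: meet_comm[of _ "?C (Suc k)"])
  then have "?M \<preceq> shift (inv z) q (?E k)"
    using z D by (intro M) (simp_all add: gcd_leI2)
  moreover have "?M \<preceq> shift \<one> 1 (?E k)"
    using z C D by (intro M) (simp_all add: gcd_leI1 gcd_leI2)
  ultimately show ?case
    using z by (simp add: sliding_conjugator_Suc le_gcd_iff)
qed

section \<open>Raising the infimum by cycling and sliding\<close>

lemma cycling_conjugator_raises_inf:
  assumes z: "z \<in> carrier G" and a: "a \<in> carrier G" "a \<preceq> \<one>" "a \<preceq> shift z (- p - 1) a"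
  obtains k where "shift \<one> 1 (cycling_conjugator z p (Suc k)) \<preceq> shift z (- p) (cycling_conjugator z p (Suc k))"
proof -
  \<comment> \<open>Dividing by the \<open>k\<close>-th power of \<open>\<Delta>\<close> turns the
    recursion into \<open>H_Suc\<close>, so \<open>H k\<close> is the gcd of 1 and its first
    \<open>k\<close> iterates under \<open>?h\<close>.\<close>
  define H where "H k = shift \<one> (- int k) (cycling_conjugator z p k)" for k
  let ?h = "shift z (- p - 1)"
  have cl: "H k \<in> carrier G" for k
    using z by (simp add: H_def)
  have H_Suc: "H (Suc k) = ?h (H k) \<and>\<^sub>G H k" for k
  proof -
    have exponent: "- p - (1 + int k) = - 1 - (p + int k)" by simp
    show ?thesis
      using z by (simp add: H_def cycling_conjugator_Suc shift_gcd shift_shift algebra_simps) (simp only: exponent)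
  qed
  have "a \<preceq> H k" for k
  proof (induction k)
    case (Suc k)
    then have "?h a \<preceq> ?h (H k)"
      using z a cl by (simp add: shift_le_iff)
    then have "a \<preceq> ?h (H k)"
      using le_trans[OF a(3)] z a cl by simp
    then show ?case
      using Suc z a cl by (simp add: H_Suc le_gcd_iff)
  qed (use a in \<open>simp add: H_def\<close>)
  moreover have "H (Suc k) \<preceq> H k" for k
    using z cl by (simp add: H_Suc gcd_le2)
  ultimately obtain k where "H (Suc k) = H k"
    using decreasing_chain_stationary[of H a] cl a by blast
  \<comment> \<open>Stated for \<open>Suc k\<close> because \<open>cycling_conjugator_Suc_le\<close>
    bounds the conjugator at successors.\<close>
  then have "H (Suc k) \<preceq> ?h (H (Suc k))"
    using H_Suc[of k] gcd_le1[of "?h (H k)" "H k"] z cl by simp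
  \<comment> \<open>The exponent \<open>Suc k\<close> undoes the division in \<open>H\<close>, and
    the extra 1 clears the -1 in \<open>?h\<close>.\<close>
  then have "shift \<one> (int (Suc k) + 1) (H (Suc k)) \<preceq> shift \<one> (int (Suc k) + 1) (?h (H (Suc k)))"
    using z cl by (simp add: shift_le_iff del: of_nat_Suc)
  then have "shift \<one> 1 (cycling_conjugator z p (Suc k)) \<preceq> shift z (- p) (cycling_conjugator z p (Suc k))"
    using z by (simp add: H_def shift_shift algebra_simps)
  then show ?thesis by (rule that)
qed

text \<open>The sliding conjugator being a gcd, its shift by \<open>\<Delta>\<close> is compared
  with the images of both factors under \<open>shift z (- p)\<close>: the cycling factor by
  \<open>C\<close>, the decycling factor by \<open>shift_decyc_ge\<close>.\<close>

lemma sliding_conjugator_raises_inf: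
  assumes z: "z \<in> carrier G" and pq: "p + 2 \<le> q"
    and C: "shift \<one> 1 (cycling_conjugator z p (Suc k)) \<preceq> shift z (- p) (cycling_conjugator z p (Suc k))"
  shows "sliding_conjugator z p q (Suc k) \<preceq> shift z (- p - 1) (sliding_conjugator z p q (Suc k))"
proof -
  let ?C = "cycling_conjugator z p (Suc k)" and ?D = "cycling_conjugator (inv z) (- q) (Suc k)" and ?E = "sliding_conjugator z p q (Suc k)"
  have E: "shift \<one> 1 ?E \<preceq> shift \<one> 1 ?C" "shift \<one> 1 ?E \<preceq> shift \<one> 1 ?D"
    using z sliding_conjugator_le_cyc sliding_conjugator_le_decyc by (simp_all add: shift_le_iff)
  have "shift \<one> 1 ?C \<preceq> shift \<one> 1 (shift z (int k - p) \<one>)"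
    using z cycling_conjugator_Suc_le by (simp add: shift_le_iff)
  then have "shift \<one> 1 ?C \<preceq> shift z (int (Suc k) - p) \<one>"
    using z by (simp add: shift_shift algebra_simps)
  then have "shift \<one> 1 ?E \<preceq> shift z (int (Suc k) - p) \<one>"
    using z le_trans[OF E(1)] by simp
  then have "shift \<one> 1 ?E \<preceq> shift z (int (Suc k) - p) \<one> \<and>\<^sub>G shift \<one> 1 ?D"
    using z E(2) by (simp add: le_gcd_iff del: of_nat_Suc)
  then have "shift \<one> 1 ?E \<preceq> shift z (- p) ?D"
    using z le_trans[OF _ shift_decyc_ge[OF z pq, of "Suc k"]] by (simp del: of_nat_Suc)
  moreover have "shift \<one> 1 ?E \<preceq> shift z (- p) ?C"
    using z le_trans[OF E(1) C] by simp
  ultimately have "shift \<one> 1 ?E \<preceq> shift z (- p) (?C \<and>\<^sub>G ?D)"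
    using z by (simp add: shift_gcd le_gcd_iff)
  moreover have "shift z (- p) (?C \<and>\<^sub>G ?D) \<preceq> shift z (- p) ?E"
    using z cycling_conjugator_gcd_decyc_le_sld[OF z pq] by (simp add: shift_le_iff)
  ultimately have "shift \<one> 1 ?E \<preceq> shift z (- p) ?E"
    using z le_trans[of "shift \<one> 1 ?E" "shift z (- p) (?C \<and>\<^sub>G ?D)" "shift z (- p) ?E"] by simp
  then show ?thesis
    using z by (simp add: shift_le_swap shift_shift)
qed

text \<open>The iterates of 1 under the shift descend and stay above \<open>a\<close>, so two
  consecutive ones agree; cancelling the automorphism carries this back to the first step.\<close>

lemma one_le_shift_if_le_one:
  assumes z: "z \<in> carrier G" and a: "a \<in> carrier G" "a \<preceq> \<one>" "a \<preceq> shift z k a"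
    and le: "shift z k \<one> \<preceq> \<one>"
  shows "\<one> \<preceq> shift z k \<one>"
proof -
  define f where "f n = (shift z k ^^ n) \<one>" for n
  have f_Suc: "f (Suc n) = shift z k (f n)" for n
    by (simp add: f_def)
  have cl: "f n \<in> carrier G" for n
    by (induction n) (use z in \<open>simp_all add: f_def\<close>)
  have le': "f (Suc n) \<preceq> f n" for n
    by (induction n) (use z le cl in \<open>simp_all add: f_Suc shift_le_iff\<close>, simp add: f_def)
  have "a \<preceq> f n" for n
  proof (induction n)
    case (Suc n)
    then have "shift z k a \<preceq> f (Suc n)"
      using z a cl by (simp add: f_Suc shift_le_iff)
    then show ?case
      using le_trans[OF a(3)] z a cl by simp
  qed (use a in \<open>simp add: f_def\<close>)
  then obtain n where "f (Suc n) = f n"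
    using decreasing_chain_stationary[of f a] cl le' a by blast
  then have "f n \<preceq> f (Suc n)"
    using cl by simp
  then have "f 0 \<preceq> f (Suc 0)"
    by (induction n) (use z cl in \<open>simp_all add: f_Suc shift_le_iff\<close>)
  then show ?thesis by (simp add: f_def)
qed

section \<open>Sliding circuits lie in the super summit set\<close>

lemma garside_inf_maximal_if_sliding_constant:
  assumes z: "z \<in> carrier G" and a: "a \<in> carrier G"
    and p: "\<And>k. garside_inf G P \<Delta> ((cyclic_sliding G P \<Delta> ^^ k) z) = p"
    and q: "\<And>k. garside_sup G P \<Delta> ((cyclic_sliding G P \<Delta> ^^ k) z) = q"
  shows "garside_inf G P \<Delta> (conjugate G z a) \<le> p"
proof (rule ccontr)
  assume "\<not> garside_inf G P \<Delta> (conjugate G z a) \<le> p"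
  then have "p + 1 \<le> garside_inf G P \<Delta> (conjugate G z a)" by simp
  then have a_le: "a \<preceq> shift z (- p - 1) a"
    using z a by (simp only: le_garside_inf_conjugate_iff) simp
  \<comment> \<open>Right multiplication by a power of \<open>\<Delta>\<close> preserves the
    post-fixed point property, so \<open>a\<close> may be replaced by some \<open>b\<close> below
    1.\<close>
  obtain l :: int where "a \<preceq> \<Delta> [^] l"
    using Delta_pow_bounds a by blast
  define b where "b = shift \<one> (- l) a"
  have "a \<preceq> shift \<one> l \<one>"
    using \<open>a \<preceq> \<Delta> [^] l\<close> by (simp add: shift_def)
  then have b: "b \<in> carrier G" "b \<preceq> \<one>"
    using z a by (simp_all add: b_def shift_le_swap)
  have b_le: "b \<preceq> shift z (- p - 1) b"
    using z a a_le by (simp add: b_def le_shift_shift)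
  have inf_z: "garside_inf G P \<Delta> z = p" and sup_z: "garside_sup G P \<Delta> z = q"
    using p[of 0] q[of 0] by simp_all
  show False
  proof (cases "p + 2 \<le> q")
    case True
    obtain k where "shift \<one> 1 (cycling_conjugator z p (Suc k)) \<preceq> shift z (- p) (cycling_conjugator z p (Suc k))"
      using cycling_conjugator_raises_inf[OF z b b_le] .
    then have "sliding_conjugator z p q (Suc k) \<preceq> shift z (- (p + 1)) (sliding_conjugator z p q (Suc k))"
      using sliding_conjugator_raises_inf[OF z True, of k] by simp
    then have "p + 1 \<le> garside_inf G P \<Delta> (conjugate G z (sliding_conjugator z p q (Suc k)))"
      using z by (simp only: le_garside_inf_conjugate_iff sliding_conjugator_closed)
    also have "\<dots> = p"
      using sliding_iter_eq_conjugate[OF z p q, of "Suc k"] p[of "Suc k"] by simp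
    finally show False by simp
  next
    case False
    \<comment> \<open>Here \<open>q\<close> is at most \<open>p + 1\<close>, so \<open>z\<close>
      lies below the power of \<open>\<Delta>\<close> with exponent \<open>p + 1\<close>.\<close>
    then have "shift z (- p - 1) \<one> \<preceq> \<one>"
      using garside_sup_conjugate_le_iff[of z \<one> "p + 1"] sup_z z
      by (simp add: shift_le_swap algebra_simps)
    then have "\<one> \<preceq> shift z (- (p + 1)) \<one>"
      using one_le_shift_if_le_one[OF z b b_le] by simp
    then have "p + 1 \<le> garside_inf G P \<Delta> z"
      using le_garside_inf_conjugate_iff[of z \<one> "p + 1"] z by simp
    then show False using inf_z by simp
  qed
qed

text \<open>Sliding never lowers the infimum, and after \<open>m * k\<close> slidings, at least
  \<open>k\<close> many, the circuit is back at \<open>z\<close>.\<close>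

lemma garside_inf_sliding_circuit:
  assumes z: "z \<in> carrier G" and m: "1 \<le> m" "(cyclic_sliding G P \<Delta> ^^ m) z = z"
  shows "garside_inf G P \<Delta> ((cyclic_sliding G P \<Delta> ^^ k) z) = garside_inf G P \<Delta> z"
proof -
  let ?f = "\<lambda>k. garside_inf G P \<Delta> ((cyclic_sliding G P \<Delta> ^^ k) z)"
  have mono: "?f i \<le> ?f j" if "i \<le> j" for i j
    using z garside_inf_cyclic_sliding_ge by (intro lift_Suc_mono_le[of ?f, OF _ that]) simp
  have "(cyclic_sliding G P \<Delta> ^^ (m * k)) z = z"
    using m(2) by (induction k) (simp_all add: funpow_add)
  then have "?f k \<le> ?f 0"
    using mono[of k "m * k"] m(1) by simp
  then show ?thesis
    using mono[of 0 k] by simp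
qed

lemma sliding_circuits_subset_super_summit_set:
  assumes x: "x \<in> carrier G"
  shows "sliding_circuits G P \<Delta> x \<subseteq> super_summit_set G P \<Delta> x"
proof
  fix z assume "z \<in> sliding_circuits G P \<Delta> x"
  then obtain c m where c: "c \<in> carrier G" "z = conjugate G x c"
    and m: "1 \<le> m" "(cyclic_sliding G P \<Delta> ^^ m) z = z"
    by (auto simp: sliding_circuits_def conjugates_def)
  have z: "z \<in> carrier G"
    using x c by simp
  have inv_m: "(cyclic_sliding G P \<Delta> ^^ m) (inv z) = inv z"
    using z m by (simp add: sliding_iter_inv)
  have p: "garside_inf G P \<Delta> ((cyclic_sliding G P \<Delta> ^^ k) z) = garside_inf G P \<Delta> z" for k
    using z m by (rule garside_inf_sliding_circuit)
  have q: "garside_sup G P \<Delta> ((cyclic_sliding G P \<Delta> ^^ k) z) = garside_sup G P \<Delta> z" for k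
    using garside_inf_sliding_circuit[OF inv_closed[OF z] m(1) inv_m, of k] z
    by (simp add: sliding_iter_inv garside_inf_inv)
  have "garside_inf G P \<Delta> (conjugate G x d) \<le> garside_inf G P \<Delta> z
      \<and> garside_sup G P \<Delta> z \<le> garside_sup G P \<Delta> (conjugate G x d)" if d: "d \<in> carrier G" for d
  proof -
    let ?a = "inv c \<otimes> d"
    have w: "conjugate G x d = conjugate G z ?a"
      using x c d by (simp add: conjugate_conjugate m_assoc[symmetric])
    have "garside_inf G P \<Delta> (conjugate G z ?a) \<le> garside_inf G P \<Delta> z"
      using z c d p q by (intro garside_inf_maximal_if_sliding_constant) simp_all
    \<comment> \<open>Sliding commutes with inversion, so the result on infima applies to
      \<open>inv z\<close> with constants \<open>- garside_sup G P \<Delta> z\<close> and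
      \<open>- garside_inf G P \<Delta> z\<close>.\<close>
    moreover have "garside_inf G P \<Delta> (conjugate G (inv z) ?a) \<le> - garside_sup G P \<Delta> z"
      using z c d p q
      by (intro garside_inf_maximal_if_sliding_constant[where q = "- garside_inf G P \<Delta> z"])
        (simp_all add: sliding_iter_inv garside_inf_inv garside_sup_inv)
    ultimately show ?thesis
      using z c d by (simp add: w inv_conjugate[symmetric] garside_inf_inv)
  qed
  then show "z \<in> super_summit_set G P \<Delta> x"
    using c by (auto simp: super_summit_set_def conjugates_def)
qed

section \<open>Preferred suffixes, transport and pullbacks\<close>

lemma right_le_iff:
  "\<lbrakk>a \<in> carrier G; b \<in> carrier G\<rbrakk> \<Longrightarrow> a \<sqsubseteq>\<^bsub>right_order G P\<^esub> b \<longleftrightarrow> inv b \<preceq> inv a"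
  by (simp add: le_iff) (simp add: right_order_def)

text \<open>Inversion is an order-reversing bijection from the right order to the left order. Since
  the meet is defined by choice, the proof shows both that the candidate is a greatest lower bound
  and that no other exists.\<close>

lemma right_gcd_eq:
  assumes ab: "a \<in> carrier G" "b \<in> carrier G"
  shows "a \<sqinter>\<^bsub>right_order G P\<^esub> b = inv (inv a \<or>\<^sub>G inv b)"
  unfolding meet_def inf_def
proof (rule some_equality)
  have iff: "greatest (right_order G P) g (Lower (right_order G P) {a, b}) \<longleftrightarrow>
      g \<in> carrier G \<and> inv a \<preceq> inv g \<and> inv b \<preceq> inv g \<and>
      (\<forall>c\<in>carrier G. inv a \<preceq> inv c \<longrightarrow> inv b \<preceq> inv c \<longrightarrow> inv g \<preceq> inv c)" for g
    using ab by (auto simp: greatest_def Lower_def right_le_iff)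
  show "greatest (right_order G P) (inv (inv a \<or>\<^sub>G inv b)) (Lower (right_order G P) {a, b})"
    using ab by (simp add: iff lcm_ge1 lcm_ge2 lcm_le_iff)
  fix g assume "greatest (right_order G P) g (Lower (right_order G P) {a, b})"
  then have g: "g \<in> carrier G" "inv a \<preceq> inv g" "inv b \<preceq> inv g"
    "\<And>c. c \<in> carrier G \<Longrightarrow> inv a \<preceq> inv c \<Longrightarrow> inv b \<preceq> inv c \<Longrightarrow> inv g \<preceq> inv c"
    by (auto simp: iff)
  have "inv g = inv a \<or>\<^sub>G inv b"
    using ab g(1-3) g(4)[of "inv (inv a \<or>\<^sub>G inv b)"]
    by (intro le_antisym) (simp_all add: lcm_le_iff lcm_ge1 lcm_ge2)
  then show "g = inv (inv a \<or>\<^sub>G inv b)"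
    using g(1) inv_inv by metis
qed

text \<open>Dual to \<open>mult_preferred_prefix_conjugate\<close>: inverting the suffix replaces
  the gcd by an lcm and, for equal infimum and supremum, the three shifts by their inverses.\<close>

lemma mult_inv_preferred_suffix_conjugate:
  assumes z: "z \<in> carrier G" and c: "c \<in> carrier G"
  defines "w \<equiv> conjugate G z c"
  shows "c \<otimes> inv (preferred_suffix G P \<Delta> w) =
    shift (inv z) (garside_inf G P \<Delta> w) c \<or>\<^sub>G shift z (- garside_sup G P \<Delta> w) c \<or>\<^sub>G shift \<one> (- 1) c"
proof -
  have w: "w \<in> carrier G"
    using z c by (simp add: w_def)
  have "inv (preferred_suffix G P \<Delta> w) = inv w \<otimes> \<Delta> [^] garside_inf G P \<Delta> w
      \<or>\<^sub>G w \<otimes> \<Delta> [^] (- garside_sup G P \<Delta> w) \<or>\<^sub>G \<Delta> [^] (- 1 :: int)"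
    using w by (simp add: preferred_suffix_def right_gcd_eq inv_mult_group int_pow_neg)
  then have "c \<otimes> inv (preferred_suffix G P \<Delta> w) = shift c 0 (inv w \<otimes> \<Delta> [^] garside_inf G P \<Delta> w
      \<or>\<^sub>G w \<otimes> \<Delta> [^] (- garside_sup G P \<Delta> w) \<or>\<^sub>G \<Delta> [^] (- 1 :: int))"
    using w c by (simp add: shift_def)
  also have "\<dots> = c \<otimes> inv w \<otimes> \<Delta> [^] garside_inf G P \<Delta> w
      \<or>\<^sub>G c \<otimes> w \<otimes> \<Delta> [^] (- garside_sup G P \<Delta> w) \<or>\<^sub>G c \<otimes> \<Delta> [^] (- 1 :: int)"
    using w c by (simp add: shift_lcm) (simp add: shift_def m_assoc)
  finally show ?thesis
    using z c by (simp add: shift_def w_def inv_conjugate mult_conjugate)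
qed

lemma super_summit_set_inf_sup_eq:
  assumes "u \<in> super_summit_set G P \<Delta> x" "v \<in> super_summit_set G P \<Delta> x"
  shows "garside_inf G P \<Delta> u = garside_inf G P \<Delta> v" "garside_sup G P \<Delta> u = garside_sup G P \<Delta> v"
  using assms by (auto simp: super_summit_set_def intro: antisym)

text \<open>The transport condition unfolds to three inequalities on \<open>t\<close>, one for each of the elements
  whose gcd is the preferred prefix of \<open>conjugate G z t\<close>; their bounds have \<open>d\<close> as lcm.\<close>

lemma le_transport_iff:
  assumes z: "z \<in> carrier G" and s: "s \<in> carrier G" and t: "t \<in> carrier G"
  defines "c \<equiv> preferred_prefix G P \<Delta> z \<otimes> s"
  defines "d \<equiv> c \<otimes> inv (preferred_suffix G P \<Delta> (conjugate G z c))"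
  assumes eq: "garside_inf G P \<Delta> (conjugate G z t) = garside_inf G P \<Delta> (conjugate G z c)"
    "garside_sup G P \<Delta> (conjugate G z t) = garside_sup G P \<Delta> (conjugate G z c)"
  shows "s \<preceq> transport G P \<Delta> z t \<longleftrightarrow> d \<preceq> t"
proof -
  let ?p = "preferred_prefix G P \<Delta> z" and ?t = "t \<otimes> preferred_prefix G P \<Delta> (conjugate G z t)"
  have c: "c \<in> carrier G"
    using z s by (simp add: c_def)
  have "?p \<otimes> transport G P \<Delta> z t = ?t"
    using z t by (simp add: transport_def m_assoc) (simp add: m_assoc[symmetric])
  then have "s \<preceq> transport G P \<Delta> z t \<longleftrightarrow> c \<preceq> ?t"
    using z s t le_mult_left[of ?p s "transport G P \<Delta> z t"] by (simp add: c_def transport_def)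
  \<comment> \<open>\<open>le_shift_swap\<close> moves each of the three shifts from
    \<open>t\<close> over to \<open>c\<close>; by \<open>eq\<close> the exponents are those of the
    suffix.\<close>
  also have "\<dots> \<longleftrightarrow> d \<preceq> t"
    using z t c by (simp add: mult_preferred_prefix_conjugate eq le_gcd_iff le_shift_swap
        d_def mult_inv_preferred_suffix_conjugate lcm_le_iff)
  finally show ?thesis .
qed

text \<open>Membership of \<open>z\<close> and of its conjugate by \<open>c\<close> makes 1 and
  \<open>c\<close> post-fixed points of \<open>shift z (- ?p)\<close> and
  \<open>shift (inv z) ?q\<close>. As \<open>d\<close> is an lcm of shifts of \<open>c\<close>
  commuting with these two maps, \<open>d\<close> and its lcm with 1 are post-fixed as well.\<close>

lemma conjugate_lcm_in_super_summit_set: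
  assumes x: "x \<in> carrier G" and z: "z \<in> super_summit_set G P \<Delta> x" and c: "c \<in> carrier G"
    and w: "conjugate G z c \<in> super_summit_set G P \<Delta> x"
  defines "d \<equiv> c \<otimes> inv (preferred_suffix G P \<Delta> (conjugate G z c))"
  shows "conjugate G z (d \<or>\<^sub>G \<one>) \<in> super_summit_set G P \<Delta> x"
proof -
  let ?p = "garside_inf G P \<Delta> z" and ?q = "garside_sup G P \<Delta> z"
  obtain b where b: "b \<in> carrier G" "z = conjugate G x b"
    using z by (auto simp: super_summit_set_def conjugates_def)
  have zc: "z \<in> carrier G"
    using x b by simp
  note eq = super_summit_set_inf_sup_eq[OF w z]
  have d: "d = shift (inv z) ?p c \<or>\<^sub>G shift z (- ?q) c \<or>\<^sub>G shift \<one> (- 1) c"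
    using zc c by (simp add: d_def mult_inv_preferred_suffix_conjugate eq)
  have dc: "d \<in> carrier G"
    using zc c by (simp add: d)
  have stable: "d \<or>\<^sub>G \<one> \<preceq> shift u k (d \<or>\<^sub>G \<one>)"
    if "u \<in> carrier G" "u \<otimes> z = z \<otimes> u" "u \<otimes> inv z = inv z \<otimes> u"
      "c \<preceq> shift u k c" "\<one> \<preceq> shift u k \<one>" for u k
    using zc c that by (auto simp: d intro!: lcm_le_shift le_shift_shift)
  have "?p \<le> garside_inf G P \<Delta> (conjugate G z (d \<or>\<^sub>G \<one>))"
    using zc c dc eq le_garside_inf_conjugate_iff[of z c ?p] le_garside_inf_conjugate_iff[of z \<one> ?p]
    by (simp add: le_garside_inf_conjugate_iff stable)
  moreover have "garside_sup G P \<Delta> (conjugate G z (d \<or>\<^sub>G \<one>)) \<le> ?q"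
    using zc c dc eq garside_sup_conjugate_le_iff[of z c ?q] garside_sup_conjugate_le_iff[of z \<one> ?q]
    by (simp add: garside_sup_conjugate_le_iff stable)
  moreover have "conjugate G z (d \<or>\<^sub>G \<one>) \<in> conjugates G x"
    using x b dc by (auto simp: conjugates_def conjugate_conjugate)
  moreover have "garside_inf G P \<Delta> v \<le> ?p \<and> ?q \<le> garside_sup G P \<Delta> v" if "v \<in> conjugates G x" for v
    using z that by (simp add: super_summit_set_def)
  ultimately show ?thesis
    unfolding super_summit_set_def by (blast intro: order_trans)
qed

end

theorem proposition3p15:
  fixes G :: "('a, 'm) monoid_scheme" (structure)
    and P :: "'a set" and \<Delta> x y z s :: 'a
  assumes "finite_type_garside_structure G P \<Delta>"
    and "carrier G \<noteq> {\<one>}"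
    and "x \<in> carrier G"
    and "z \<in> sliding_circuits G P \<Delta> x"
    and "y = cyclic_sliding G P \<Delta> z"
    and "s \<in> P"
    and "conjugate G y s \<in> super_summit_set G P \<Delta> x"
  shows "is_pullback G P \<Delta> x z s
    ((preferred_prefix G P \<Delta> z \<otimes> s \<otimes> inv (preferred_suffix G P \<Delta> (conjugate G y s)))
      \<squnion>\<^bsub>left_order G P\<^esub> \<one>)"
proof -
  interpret nontrivial_garside_structure G P \<Delta>
    using assms(1,2) by (simp add: nontrivial_garside_structure_def
        nontrivial_garside_structure_axioms_def finite_type_garside_structure_def)
  define c where "c = preferred_prefix G P \<Delta> z \<otimes> s"
  define d where "d = c \<otimes> inv (preferred_suffix G P \<Delta> (conjugate G z c))"
  define t where "t = d \<or>\<^sub>G \<one>"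
  have z: "z \<in> super_summit_set G P \<Delta> x"
    using assms(3,4) sliding_circuits_subset_super_summit_set by blast
  then have zc: "z \<in> carrier G"
    using assms(3) by (auto simp: super_summit_set_def conjugates_def)
  have s: "s \<in> carrier G"
    using assms(6) by (rule positive_closed)
  have c: "c \<in> carrier G"
    using zc s by (simp add: c_def)
  have w: "conjugate G y s = conjugate G z c"
    using zc s by (simp add: assms(5) cyclic_sliding_def conjugate_conjugate c_def)
  then have wS: "conjugate G z c \<in> super_summit_set G P \<Delta> x"
    using assms(7) by simp
  have d: "d \<in> carrier G"
    using zc c by (simp add: d_def mult_inv_preferred_suffix_conjugate)
  have t: "t \<in> carrier G" "t \<in> P"
    using d by (simp_all add: t_def positive_iff lcm_ge2)
  \<comment> \<open>Elements of the super summit set share infimum and supremum, so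
    \<open>le_transport_iff\<close> applies to every candidate; positivity supplies the bound by 1
    in \<open>t\<close>.\<close>
  have candidate_iff: "a \<in> pullback_candidates G P \<Delta> x z s \<longleftrightarrow>
      a \<in> carrier G \<and> conjugate G z a \<in> super_summit_set G P \<Delta> x \<and> t \<preceq> a" for a
  proof (cases "a \<in> carrier G \<and> conjugate G z a \<in> super_summit_set G P \<Delta> x")
    case True
    then have "s \<preceq> transport G P \<Delta> z a \<longleftrightarrow> d \<preceq> a"
      using zc s super_summit_set_inf_sup_eq[OF _ wS, of "conjugate G z a"]
      by (simp add: le_transport_iff c_def d_def)
    then show ?thesis
      using True d by (auto simp: pullback_candidates_def t_def lcm_le_iff positive_iff)
  qed (auto simp: pullback_candidates_def positive_closed)
  have "conjugate G z t \<in> super_summit_set G P \<Delta> x"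
    unfolding t_def d_def using assms(3) z c wS by (rule conjugate_lcm_in_super_summit_set)
  then have "t \<in> pullback_candidates G P \<Delta> x z s"
    using t by (simp add: candidate_iff)
  \<comment> \<open>As a lower bound of the candidates that is itself a candidate, \<open>t\<close>
    is the least one and hence the only minimal one.\<close>
  then have "is_pullback G P \<Delta> x z s t"
    using t(1) le_antisym[of _ t] by (auto simp: is_pullback_def is_minimal_in_def candidate_iff)
  then show ?thesis
    by (simp add: t_def d_def c_def w)
qed

end
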